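(* Let $\mathbb{H}$ and $\mathbb{K}$ be complex Hilbert spaces, and let $A$ be a bounded linear operator on $\mathbb{H}$ and $B$ a bounded linear operator on $\mathbb{K}$. Then the equality $w(A \otimes B)=\frac{\|A\|\|B\|}{2}$ holds if and only if $$\| e^{i\theta} A \otimes B+e^{-i\theta}A^* \otimes B^*\|=\|e^{i\theta}A \otimes B-e^{-i\theta}A^* \otimes B^*\|=\|A\|\|B\| \quad\text{for all } \theta \in \mathbb{R}.$$
   Context: For a bounded linear operator $T$ on a complex Hilbert space with inner product $\langle\cdot,\cdot\rangle$, the numerical radius is $w(T)=\sup\{|\langle Tx,x\rangle| : \|x\|=1\}$, and $\|T\|$ is the operator norm. $\mathbb{H}\otimes\mathbb{K}$ is the Hilbert space tensor product (the completion of the algebraic tensor product under the inner product determined by $\langle x\otimes y,z\otimes u\rangle=\langle x,z\rangle\langle y,u\rangle$), and $A\otimes B$ is the bounded linear operator on $\mathbb{H}\otimes\mathbb{K}$ determined by $(A\otimes B)(x\otimes y)=Ax\otimes By$. *)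

theory Defs
  imports "HOL-Analysis.Analysis"
begin

class complex_vector = real_vector +
  fixes scaleC :: "complex \<Rightarrow> 'a \<Rightarrow> 'a"  (infixr \<open>*\<^sub>C\<close> 75)
  assumes scaleC_add_right: "c *\<^sub>C (x + y) = c *\<^sub>C x + c *\<^sub>C y"
    and scaleC_add_left: "(c + d) *\<^sub>C x = c *\<^sub>C x + d *\<^sub>C x"
    and scaleC_scaleC: "c *\<^sub>C d *\<^sub>C x = (c * d) *\<^sub>C x"
    and scaleC_one: "1 *\<^sub>C x = x"
    and scaleR_scaleC: "r *\<^sub>R x = complex_of_real r *\<^sub>C x"

interpretation complex_vector: vector_space "scaleC :: complex \<Rightarrow> 'a \<Rightarrow> 'a::complex_vector"
  by unfold_locales (rule scaleC_add_right scaleC_add_left scaleC_scaleC scaleC_one)+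

text \<open>The inner product is linear in its first and conjugate-linear in its second argument.\<close>

class complex_inner = complex_vector + real_normed_vector +
  fixes cinner :: "'a \<Rightarrow> 'a \<Rightarrow> complex"
  assumes cinner_commute: "cinner x y = cnj (cinner y x)"
    and cinner_add_left: "cinner (x + y) z = cinner x z + cinner y z"
    and cinner_scaleC_left: "cinner (c *\<^sub>C x) y = c * cinner x y"
    and cinner_self: "cinner x x = complex_of_real ((norm x)\<^sup>2)"

class chilbert_space = complex_inner + complete_space

definition bounded_clinear :: "('a::complex_inner \<Rightarrow> 'b::complex_inner) \<Rightarrow> bool" where
  "bounded_clinear T \<longleftrightarrow> bounded_linear T \<and> (\<forall>c x. T (c *\<^sub>C x) = c *\<^sub>C T x)"

text \<open>All values in the set are nonnegative, so inserting \<open>0\<close> changes the supremum only on the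
  zero space, which has no unit vectors; there the numerical radius is \<open>0\<close>.\<close>

definition numerical_radius :: "('a::complex_inner \<Rightarrow> 'a) \<Rightarrow> real" where
  "numerical_radius T = Sup (insert 0 {cmod (cinner (T x) x) | x. norm x = 1})"

definition cadjoint :: "('a::chilbert_space \<Rightarrow> 'b::chilbert_space) \<Rightarrow> 'b \<Rightarrow> 'a" where
  "cadjoint T = (THE S. bounded_clinear S \<and> (\<forall>x y. cinner (T x) y = cinner x (S y)))"

text \<open>A Hilbert space \<open>'c\<close> with a bilinear map \<open>tensor\<close> is a completion of the algebraic tensor
  product of \<open>'a\<close> and \<open>'b\<close>: the span of the simple tensors carries the inner product
  determined by \<open>cinner_tensor\<close> (as that form is positive definite on the algebraic tensor
  product, the canonical map onto this span is injective), and it is dense in the complete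
  space \<open>'c\<close>. This determines \<open>'c\<close> together with \<open>tensor\<close> up to a unique unitary
  isomorphism.\<close>

locale hilbert_tensor_product =
  fixes tensor :: "'a::chilbert_space \<Rightarrow> 'b::chilbert_space \<Rightarrow> 'c::chilbert_space"
  assumes tensor_add_left: "tensor (x + x') y = tensor x y + tensor x' y"
    and tensor_add_right: "tensor x (y + y') = tensor x y + tensor x y'"
    and tensor_scaleC_left: "tensor (c *\<^sub>C x) y = c *\<^sub>C tensor x y"
    and tensor_scaleC_right: "tensor x (c *\<^sub>C y) = c *\<^sub>C tensor x y"
    and cinner_tensor: "cinner (tensor x y) (tensor z u) = cinner x z * cinner y u"
    and dense_span_tensor: "closure (complex_vector.span {tensor x y | x y. True}) = UNIV"

definition tensor_op ::
  "('a::chilbert_space \<Rightarrow> 'b::chilbert_space \<Rightarrow> 'c::chilbert_space)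
    \<Rightarrow> ('a \<Rightarrow> 'a) \<Rightarrow> ('b \<Rightarrow> 'b) \<Rightarrow> 'c \<Rightarrow> 'c" where
  "tensor_op tensor A B =
    (THE T. bounded_clinear T \<and> (\<forall>x y. T (tensor x y) = tensor (A x) (B y)))"

end

theory Submission
  imports Defs
begin

text \<open>
  Put \<open>T = A \<otimes> B\<close>, so that \<open>T\<^sup>* = A\<^sup>* \<otimes> B\<^sup>*\<close> and \<open>\<parallel>T\<parallel> = \<parallel>A\<parallel> \<parallel>B\<parallel>\<close>. The tensor
  structure enters only through these two facts; the rest is a statement about a single operator,
  \<open>numerical_radius_eq_half_norm_iff\<close>.

  Write \<open>P \<theta> = exp(i\<theta>) T + exp(-i\<theta>) T\<^sup>*\<close> and \<open>M \<theta> = exp(i\<theta>) T - exp(-i\<theta>) T\<^sup>*\<close>. The operator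
  \<open>P \<theta>\<close> is self-adjoint, hence its norm is the supremum on unit vectors
  of the absolute value of its quadratic form \<open>2 Re (exp(i\<theta>) \<langle>T x, x\<rangle>)\<close>, and maximising over \<open>\<theta>\<close> as well gives
  \<open>2 w(T) = sup\<^sub>\<theta> \<parallel>P \<theta>\<parallel>\<close>. If all these norms are \<open>\<parallel>T\<parallel>\<close>, then \<open>w(T) = \<parallel>T\<parallel> / 2\<close>.
  Conversely let \<open>w(T) = \<parallel>T\<parallel> / 2\<close>. Then \<open>\<parallel>P \<theta>\<parallel> \<le> \<parallel>T\<parallel>\<close> for all \<open>\<theta>\<close>, and also
  \<open>\<parallel>M \<theta>\<parallel> \<le> \<parallel>T\<parallel>\<close> because \<open>M \<theta> = i P (\<theta> - \<pi>/2)\<close>. But \<open>2 exp(i\<theta>) T = P \<theta> + M \<theta>\<close> forces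
  \<open>2 \<parallel>T\<parallel> \<le> \<parallel>P \<theta>\<parallel> + \<parallel>M \<theta>\<parallel>\<close>, so both inequalities are equalities.

  Adjoints come from the Riesz representation theorem. The substance of the existence of
  \<open>A \<otimes> B\<close> is the bound \<open>\<parallel>\<Sum>\<^sub>i A x\<^sub>i \<otimes> B y\<^sub>i\<parallel> \<le> \<parallel>A\<parallel> \<parallel>B\<parallel> \<parallel>\<Sum>\<^sub>i x\<^sub>i \<otimes> y\<^sub>i\<parallel>\<close>: it makes the assignment
  on finite sums well defined and lets it extend to the completion. With \<open>B\<close> the identity it
  follows by rewriting the sum so that the \<open>y\<^sub>i\<close> are orthonormal, which turns both norms into
  sums of squares; exchanging the factors gives the case of \<open>A\<close> the identity, and the two cases
  compose.
\<close>

section \<open>Complex inner product spaces\<close>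

lemma cinner_add_right: "cinner x (y + z) = cinner x y + cinner x z"
  by (metis cinner_add_left cinner_commute complex_cnj_add)

lemma cinner_scaleC_right: "cinner x (c *\<^sub>C y) = cnj c * cinner x y"
  by (metis cinner_commute cinner_scaleC_left complex_cnj_mult)

lemma cinner_scaleR_left: "cinner (r *\<^sub>R x) y = of_real r * cinner x y"
  by (simp add: scaleR_scaleC cinner_scaleC_left)

lemma cinner_scaleR_right: "cinner x (r *\<^sub>R y) = of_real r * cinner x y"
  by (simp add: scaleR_scaleC cinner_scaleC_right)

lemma Re_cinner_commute: "Re (cinner x y) = Re (cinner y x)"
  by (metis cinner_commute cnj.simps(1))

lemma Re_cinner_self: "Re (cinner x x) = (norm x)\<^sup>2"
  by (simp add: cinner_self)

lemma norm_add_square: "(norm (x + y))\<^sup>2 = (norm x)\<^sup>2 + 2 * Re (cinner x y) + (norm y)\<^sup>2"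
  for x y :: "'a::complex_inner"
  using Re_cinner_self[of "x + y"] Re_cinner_commute[of x y]
  by (simp add: cinner_add_left cinner_add_right Re_cinner_self)

lemma norm_scaleC: "norm (c *\<^sub>C x) = cmod c * norm x"
  for x :: "'a::complex_inner"
proof -
  have "complex_of_real ((norm (c *\<^sub>C x))\<^sup>2) = c * cnj c * complex_of_real ((norm x)\<^sup>2)"
    by (simp add: cinner_self[symmetric] cinner_scaleC_left cinner_scaleC_right del: of_real_power)
  also have "\<dots> = complex_of_real ((cmod c * norm x)\<^sup>2)"
    by (simp only: power_mult_distrib of_real_mult complex_norm_square)
  finally have "(norm (c *\<^sub>C x))\<^sup>2 = (cmod c * norm x)\<^sup>2"
    using of_real_eq_iff by blast
  then show ?thesis
    by (simp add: power2_eq_iff_nonneg)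
qed

lemma Re_cinner_le: "Re (cinner x y) \<le> norm x * norm y"
  for x y :: "'a::complex_inner"
proof -
  have "(norm (x + y))\<^sup>2 \<le> (norm x + norm y)\<^sup>2"
    by (simp add: norm_triangle_ineq power_mono)
  then show ?thesis
    by (simp add: norm_add_square power2_sum)
qed

lemma unimodular_rotation: "\<exists>\<theta>. exp (\<i> * complex_of_real \<theta>) * z = complex_of_real (cmod z)"
proof -
  have "z = complex_of_real (cmod z) * exp (\<i> * complex_of_real (Arg z))"
    by (metis rcis_cmod_Arg rcis_def cis_conv_exp)
  then have "exp (\<i> * complex_of_real (- Arg z)) * z
      = complex_of_real (cmod z) * (exp (\<i> * complex_of_real (Arg z)) * exp (\<i> * complex_of_real (- Arg z)))"
    by (metis mult.commute mult.left_commute)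
  then show ?thesis
    by (metis exp_minus_inverse mult.right_neutral mult_minus_right of_real_minus)
qed

text \<open>The triangle inequality bounds the real part of the inner product; rotating one argument
  makes the inner product real.\<close>

lemma cauchy_schwarz: "cmod (cinner x y) \<le> norm x * norm y"
  for x y :: "'a::complex_inner"
proof -
  obtain \<theta> where "exp (\<i> * complex_of_real \<theta>) * cinner x y = complex_of_real (cmod (cinner x y))"
    using unimodular_rotation by blast
  then have "cmod (cinner x y) = Re (cinner (exp (\<i> * complex_of_real \<theta>) *\<^sub>C x) y)"
    by (simp add: cinner_scaleC_left)
  also have "\<dots> \<le> norm (exp (\<i> * complex_of_real \<theta>) *\<^sub>C x) * norm y"
    by (rule Re_cinner_le)
  also have "\<dots> = norm x * norm y"
    by (simp add: norm_scaleC)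
  finally show ?thesis .
qed

interpretation cinner: bounded_bilinear "cinner :: 'a::complex_inner \<Rightarrow> 'a \<Rightarrow> complex"
proof
  show "\<exists>K. \<forall>a b :: 'a. cmod (cinner a b) \<le> norm a * norm b * K"
    by (rule exI[of _ 1]) (simp add: cauchy_schwarz)
qed (simp_all add: cinner_add_left cinner_add_right cinner_scaleR_left cinner_scaleR_right
      scaleR_conv_of_real)

lemma cinner_ext: "(\<And>z. cinner z x = cinner z y) \<Longrightarrow> x = y"
  for x y :: "'a::complex_inner"
proof -
  assume "\<And>z. cinner z x = cinner z y"
  then have "cinner (x - y) (x - y) = 0"
    by (simp add: cinner.diff_right)
  then show "x = y"
    by (simp add: cinner_self)
qed

lemma bounded_linear_scaleC: "bounded_linear (\<lambda>x :: 'a::complex_inner. c *\<^sub>C x)"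
  by (rule bounded_linear_intro[where K = "cmod c"])
    (simp_all add: scaleC_add_right scaleR_scaleC scaleC_scaleC norm_scaleC mult.commute)

lemma bounded_clinearD:
  assumes "bounded_clinear T"
  shows "bounded_linear T" "T (x + y) = T x + T y" "T (c *\<^sub>C x) = c *\<^sub>C T x"
  using assms by (auto simp: bounded_clinear_def linear_add bounded_linear.linear)

lemma bounded_clinear_intro:
  assumes "\<And>x y. T (x + y) = T x + T y" "\<And>c x. T (c *\<^sub>C x) = c *\<^sub>C T x"
    and "\<And>x. norm (T x) \<le> K * norm x"
  shows "bounded_clinear T"
  unfolding bounded_clinear_def
proof (intro conjI allI)
  show "bounded_linear T"
    by (rule bounded_linear_intro[where K = K]) (simp_all add: assms scaleR_scaleC mult.commute)
qed (rule assms)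

section \<open>The Riesz representation theorem and adjoints\<close>

text \<open>The functional \<open>f\<close> is represented by the maximiser of the strictly concave function
  \<open>2 Re (f x) - \<parallel>x\<parallel>\<^sup>2\<close>: by the parallelogram identity every maximising
  sequence is Cauchy, and the vanishing derivative at the maximum is the claim.\<close>

theorem riesz_representation:
  fixes f :: "'a::chilbert_space \<Rightarrow> complex"
  assumes f: "bounded_linear f" and fC: "\<And>c x. f (c *\<^sub>C x) = c * f x"
  obtains z where "\<And>x. f x = cinner x z"
proof -
  interpret f: bounded_linear f by (rule f)
  define \<phi> where "\<phi> x = 2 * Re (f x) - (norm x)\<^sup>2" for x
  obtain K where K: "\<And>x. cmod (f x) \<le> norm x * K" using f.bounded by blast
  have bound: "\<phi> x \<le> K\<^sup>2" for x
  proof -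
    have "Re (f x) \<le> norm x * K" using K[of x] complex_Re_le_cmod[of "f x"] by linarith
    moreover have "0 \<le> (norm x - K)\<^sup>2" by simp
    ultimately show ?thesis by (simp add: \<phi>_def power2_diff)
  qed
  define d where "d = (SUP x. \<phi> x)"
  have bdd: "bdd_above (range \<phi>)" using bound by (auto simp: bdd_above_def)
  have le_d: "\<phi> x \<le> d" for x unfolding d_def by (rule cSUP_upper[OF _ bdd]) simp
  have "\<exists>x. d - 1 / real (Suc n) < \<phi> x" for n
  proof -
    have "d - 1 / real (Suc n) < (SUP x. \<phi> x)" by (simp add: d_def)
    then show ?thesis using less_cSUP_iff[OF _ bdd] by auto
  qed
  then obtain X where X: "\<And>n. d - 1 / real (Suc n) < \<phi> (X n)" by metis
  have midpoint: "\<phi> ((1/2) *\<^sub>R (x + y)) = \<phi> x / 2 + \<phi> y / 2 + (norm (x - y))\<^sup>2 / 4" for x y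
  proof -
    have "(norm (x - y))\<^sup>2 = (norm x)\<^sup>2 - 2 * Re (cinner x y) + (norm y)\<^sup>2"
      using norm_add_square[of x "- y"] by (simp add: cinner.minus_right)
    moreover have half: "norm ((1/2) *\<^sub>R (x + y)) = norm (x + y) / 2"
      by (simp only: norm_scaleR abs_divide abs_numeral abs_one mult_1 times_divide_eq_left)
    ultimately show ?thesis
      unfolding \<phi>_def f.scaleR half
      by (simp add: f.add power_divide norm_add_square field_simps)
  qed
  have gap: "(norm (x - y))\<^sup>2 \<le> 2 * (d - \<phi> x) + 2 * (d - \<phi> y)" for x y
    using le_d[of "(1/2) *\<^sub>R (x + y)"] unfolding midpoint by argo
  have "Cauchy X"
  proof (rule metric_CauchyI)
    fix e :: real assume e: "0 < e"
    obtain M where M: "4 / e\<^sup>2 < real M" using reals_Archimedean2 by blast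
    have Mpos: "0 < real M" using M e by (meson divide_pos_pos less_trans zero_less_numeral zero_less_power)
    have "dist (X m) (X n) < e" if "M \<le> m" "M \<le> n" for m n
    proof -
      have "1 / real (Suc k) \<le> 1 / real M" if "M \<le> k" for k
        using that Mpos by (intro divide_left_mono) auto
      then have small: "d - \<phi> (X k) < 1 / real M" if "M \<le> k" for k
        using X[of k] that by (smt (verit))
      have "(norm (X m - X n))\<^sup>2 < 4 * (1 / real M)"
        using gap[of "X m" "X n"] small[OF that(1)] small[OF that(2)] by argo
      also have "\<dots> \<le> e\<^sup>2" using M Mpos e by (simp add: field_simps)
      finally show ?thesis using e by (simp add: dist_norm power_less_imp_less_base)
    qed
    then show "\<exists>M. \<forall>m\<ge>M. \<forall>n\<ge>M. dist (X m) (X n) < e" by blast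
  qed
  then obtain z where z: "X \<longlonglongrightarrow> z" using Cauchy_convergent convergent_def by blast
  have "(\<lambda>n. \<phi> (X n)) \<longlonglongrightarrow> \<phi> z"
    unfolding \<phi>_def by (intro tendsto_intros f.tendsto z)
  moreover have "(\<lambda>n. d - 1 / real (Suc n)) \<longlonglongrightarrow> d"
    using tendsto_diff[OF tendsto_const LIMSEQ_Suc[OF lim_1_over_n]] by simp
  ultimately have "d \<le> \<phi> z"
    using X by (intro LIMSEQ_le[of "\<lambda>n. d - 1 / real (Suc n)" _ "\<lambda>n. \<phi> (X n)"])
      (auto intro: less_imp_le)
  then have max: "\<phi> x \<le> \<phi> z" for x using le_d[of x] by linarith
  have Re_eq: "Re (f h) = Re (cinner h z)" for h
  proof -
    define a where "a = Re (f h) - Re (cinner h z)"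
    have quad: "2 * t * a \<le> t\<^sup>2 * (norm h)\<^sup>2" for t
      using max[of "z + t *\<^sub>R h"] Re_cinner_commute[of h z]
      by (simp add: \<phi>_def a_def f.add f.scaleR norm_add_square cinner_scaleR_right
          power_mult_distrib algebra_simps)
    \<comment> \<open>This step size makes the linear term beat the quadratic one unless \<open>a = 0\<close>;
      the \<open>+ 1\<close> keeps it defined for \<open>h = 0\<close>.\<close>
    define s where "s = (norm h)\<^sup>2 + 1"
    have s: "0 < s" by (simp add: s_def add_nonneg_pos)
    have "2 * (a / s) * a \<le> (a / s)\<^sup>2 * s"
      using quad[of "a / s"] by (simp add: s_def distrib_left order_trans[OF _ le_add_same_cancel1[THEN iffD2]])
    then have "a\<^sup>2 / s \<le> 0" using s by (simp add: power2_eq_square field_simps)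
    then have "a = 0" using s by (simp add: divide_le_0_iff)
    then show ?thesis by (simp add: a_def)
  qed
  \<comment> \<open>The imaginary parts are the real parts at \<open>i x\<close>, up to sign.\<close>
  have "f x = cinner x z" for x
    using Re_eq[of x] Re_eq[of "\<i> *\<^sub>C x"] by (simp add: complex_eq_iff fC cinner_scaleC_left)
  then show thesis by (rule that)
qed

lemma adjoint_exists:
  fixes T :: "'a::chilbert_space \<Rightarrow> 'b::chilbert_space"
  assumes T: "bounded_clinear T"
  shows "\<exists>S. bounded_clinear S \<and> (\<forall>x y. cinner (T x) y = cinner x (S y))"
proof -
  interpret T: bounded_linear T using T by (rule bounded_clinearD)
  have "\<exists>z. \<forall>x. cinner (T x) y = cinner x z" for y
  proof -
    have "bounded_linear (\<lambda>x. cinner (T x) y)"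
      by (rule bounded_linear_compose[OF cinner.bounded_linear_left T.bounded_linear_axioms])
    then show ?thesis
      by (rule riesz_representation)
        (auto simp: bounded_clinearD(3)[OF T] cinner_scaleC_left)
  qed
  then obtain S where S: "\<And>x y. cinner (T x) y = cinner x (S y)" by metis
  have "bounded_clinear S"
  proof (rule bounded_clinear_intro)
    show "S (x + y) = S x + S y" for x y
      by (rule cinner_ext) (simp add: S[symmetric] cinner_add_right)
    show "S (c *\<^sub>C x) = c *\<^sub>C S x" for c x
      by (rule cinner_ext) (simp add: S[symmetric] cinner_scaleC_right)
    show "norm (S y) \<le> onorm T * norm y" for y
    proof (cases "S y = 0")
      case False
      have "(norm (S y))\<^sup>2 = cmod (cinner (T (S y)) y)"
        by (simp add: S cinner_self norm_power)
      also have "\<dots> \<le> norm (T (S y)) * norm y" by (rule cauchy_schwarz)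
      also have "\<dots> \<le> onorm T * norm (S y) * norm y"
        by (intro mult_right_mono onorm T.bounded_linear_axioms) simp
      finally show ?thesis using False by (simp add: power2_eq_square mult.assoc mult.left_commute)
    qed (simp add: onorm_pos_le T.bounded_linear_axioms)
  qed
  with S show ?thesis by blast
qed

lemma cadjoint:
  assumes "bounded_clinear T"
  shows bounded_clinear_cadjoint: "bounded_clinear (cadjoint T)"
    and cinner_cadjoint: "cinner (T x) y = cinner x (cadjoint T y)"
proof -
  have "\<exists>!S. bounded_clinear S \<and> (\<forall>x y. cinner (T x) y = cinner x (S y))"
    using adjoint_exists[OF assms] by (metis cinner_ext ext)
  from theI'[OF this, folded cadjoint_def] show "bounded_clinear (cadjoint T)" "cinner (T x) y = cinner x (cadjoint T y)"
    by blast+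
qed

section \<open>The numerical radius and the rotated real parts\<close>

text \<open>For self-adjoint \<open>H\<close>, polarisation expresses \<open>4 Re \<langle>H x, y\<rangle>\<close> through the quadratic form at
  \<open>x + y\<close> and \<open>x - y\<close>, and the parallelogram identity sums the two bounds.\<close>

lemma norm_le_of_quadratic_form_le:
  fixes H :: "'a::complex_inner \<Rightarrow> 'a"
  assumes H: "bounded_linear H"
    and selfadjoint: "\<And>x y. cinner (H x) y = cinner x (H y)"
    and form: "\<And>x. cmod (cinner (H x) x) \<le> c * (norm x)\<^sup>2"
  shows "norm (H x) \<le> c * norm x"
proof (cases "H x = 0 \<or> x = 0")
  case True
  have "0 \<le> c" if "x \<noteq> 0"
    using order_trans[OF norm_ge_zero form[of x]] that by (simp add: zero_le_mult_iff)
  with True show ?thesis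
    using bounded_linear.linear[OF H] by (cases "x = 0") (auto simp: linear_0)
next
  case False
  interpret H: bounded_linear H by (rule H)
  have "4 * Re (cinner (H x) y) \<le> 2 * c * ((norm x)\<^sup>2 + (norm y)\<^sup>2)" for y
  proof -
    have "Re (cinner (H y) x) = Re (cinner (H x) y)"
      by (metis selfadjoint Re_cinner_commute)
    then have "4 * Re (cinner (H x) y)
        = Re (cinner (H (x + y)) (x + y)) - Re (cinner (H (x - y)) (x - y))"
      by (simp add: H.add H.diff cinner.add_left cinner.add_right cinner.diff_left cinner.diff_right)
    also have "\<dots> \<le> c * (norm (x + y))\<^sup>2 + c * (norm (x - y))\<^sup>2"
      using form[of "x + y"] form[of "x - y"] abs_Re_le_cmod[of "cinner (H (x + y)) (x + y)"]
        abs_Re_le_cmod[of "cinner (H (x - y)) (x - y)"] by linarith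
    also have "\<dots> = c * ((norm (x + y))\<^sup>2 + (norm (x - y))\<^sup>2)"
      by (simp add: distrib_left)
    also have "(norm (x + y))\<^sup>2 + (norm (x - y))\<^sup>2 = 2 * ((norm x)\<^sup>2 + (norm y)\<^sup>2)"
      using norm_add_square[of x y] norm_add_square[of x "- y"]
      by (simp add: cinner.minus_right)
    also have "c * (2 * ((norm x)\<^sup>2 + (norm y)\<^sup>2)) = 2 * c * ((norm x)\<^sup>2 + (norm y)\<^sup>2)"
      by simp
    finally show ?thesis .
  qed
  \<comment> \<open>Test with the vector of length \<open>\<parallel>x\<parallel>\<close> in the direction of \<open>H x\<close>.\<close>
  from this[of "(norm x / norm (H x)) *\<^sub>R H x"] False
  have "4 * (norm x * norm (H x)) \<le> 4 * (c * (norm x * norm x))"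
    by (simp add: cinner_scaleR_right Re_cinner_self power2_eq_square)
  with False show ?thesis by (simp add: mult.left_commute)
qed

context
  fixes T :: "'a::complex_inner \<Rightarrow> 'a"
  assumes T: "bounded_clinear T"
begin

lemma cmod_cinner_op_le: "cmod (cinner (T x) x) \<le> onorm T * (norm x)\<^sup>2"
proof -
  have "cmod (cinner (T x) x) \<le> norm (T x) * norm x" by (rule cauchy_schwarz)
  also have "\<dots> \<le> onorm T * norm x * norm x"
    by (intro mult_right_mono onorm bounded_clinearD(1)[OF T]) simp
  finally show ?thesis by (simp add: power2_eq_square)
qed

lemma bdd_above_numerical_range: "bdd_above (insert 0 {cmod (cinner (T x) x) | x. norm x = 1})"
proof (rule bdd_aboveI)
  fix r assume "r \<in> insert 0 {cmod (cinner (T x) x) | x. norm x = 1}"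
  then consider "r = 0" | x where "r = cmod (cinner (T x) x)" "norm x = 1" by blast
  then show "r \<le> onorm T"
  proof cases
    case (2 x)
    then show ?thesis using cmod_cinner_op_le[of x] by simp
  qed (simp add: onorm_pos_le bounded_clinearD(1)[OF T])
qed

lemma numerical_radius_nonneg: "0 \<le> numerical_radius T"
  unfolding numerical_radius_def by (intro cSup_upper bdd_above_numerical_range) simp

lemma quadratic_form_le_numerical_radius:
  "cmod (cinner (T x) x) \<le> numerical_radius T * (norm x)\<^sup>2"
proof (cases "x = 0")
  case False
  define u where "u = (1 / norm x) *\<^sub>R x"
  have u: "norm u = 1" and "x = norm x *\<^sub>R u"
    using False by (simp_all add: u_def)
  then have x: "x = complex_of_real (norm x) *\<^sub>C u"
    by (simp add: scaleR_scaleC)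
  have "cmod (cinner (T u) u) \<le> numerical_radius T"
    unfolding numerical_radius_def using u by (intro cSup_upper bdd_above_numerical_range) auto
  moreover have "cmod (cinner (T x) x) = cmod (cinner (T u) u) * (norm x)\<^sup>2"
    by (subst (1 2) x) (simp add: bounded_clinearD(3)[OF T] cinner_scaleC_left cinner_scaleC_right
        norm_mult power2_eq_square)
  ultimately show ?thesis by (simp add: mult_right_mono)
qed (simp add: cinner.zero_right)

end

lemma numerical_radius_leI:
  assumes "0 \<le> c" "\<And>x. norm x = 1 \<Longrightarrow> cmod (cinner (T x) x) \<le> c"
  shows "numerical_radius T \<le> c"
  unfolding numerical_radius_def using assms by (intro cSup_least) auto

text \<open>In the proof, \<open>P \<theta>\<close> and \<open>M \<theta>\<close> are twice the real part and \<open>2 i\<close> times the imaginary part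
  of \<open>exp(i\<theta>) T\<close>. The bounds \<open>P_le\<close> and \<open>w_le\<close> together say that \<open>2 w(T)\<close> is the supremum of
  \<open>\<parallel>P \<theta>\<parallel>\<close>; \<open>M_eq\<close> and \<open>T_le\<close> then force equality everywhere once \<open>w(T) = \<parallel>T\<parallel> / 2\<close>.\<close>

theorem numerical_radius_eq_half_norm_iff:
  fixes T S :: "'a::complex_inner \<Rightarrow> 'a"
  assumes T: "bounded_clinear T" and S: "bounded_clinear S"
    and adj: "\<And>x y. cinner (T x) y = cinner x (S y)"
  shows "numerical_radius T = onorm T / 2 \<longleftrightarrow>
    (\<forall>\<theta>::real.
      onorm (\<lambda>v. exp (\<i> * complex_of_real \<theta>) *\<^sub>C T v + exp (- \<i> * complex_of_real \<theta>) *\<^sub>C S v)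
        = onorm (\<lambda>v. exp (\<i> * complex_of_real \<theta>) *\<^sub>C T v - exp (- \<i> * complex_of_real \<theta>) *\<^sub>C S v)
    \<and> onorm (\<lambda>v. exp (\<i> * complex_of_real \<theta>) *\<^sub>C T v - exp (- \<i> * complex_of_real \<theta>) *\<^sub>C S v)
        = onorm T)"
proof -
  define e where "e \<theta> = exp (\<i> * complex_of_real \<theta>)" for \<theta>
  define P where "P \<theta> v = e \<theta> *\<^sub>C T v + cnj (e \<theta>) *\<^sub>C S v" for \<theta> v
  define M where "M \<theta> v = e \<theta> *\<^sub>C T v - cnj (e \<theta>) *\<^sub>C S v" for \<theta> v
  have cnj_e: "exp (- \<i> * complex_of_real \<theta>) = cnj (e \<theta>)" for \<theta>
    by (simp add: e_def exp_cnj)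
  have P_fun: "(\<lambda>v. exp (\<i> * complex_of_real \<theta>) *\<^sub>C T v
        + exp (- \<i> * complex_of_real \<theta>) *\<^sub>C S v) = P \<theta>"
    and M_fun: "(\<lambda>v. exp (\<i> * complex_of_real \<theta>) *\<^sub>C T v
        - exp (- \<i> * complex_of_real \<theta>) *\<^sub>C S v) = M \<theta>"
    for \<theta>
    by (simp_all only: fun_eq_iff P_def M_def cnj_e) (simp_all add: e_def)
  have e_cis: "e \<theta> = cis \<theta>" for \<theta> by (simp add: e_def cis_conv_exp)
  have cmod_e: "cmod (e \<theta>) = 1" for \<theta> by (simp add: e_def)
  have bT: "bounded_linear T" and bS: "bounded_linear S"
    using T S by (auto dest: bounded_clinearD)
  have bP: "bounded_linear (P \<theta>)" and bM: "bounded_linear (M \<theta>)" for \<theta>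
    unfolding P_def M_def
    by (intro bounded_linear_add bounded_linear_sub
        bounded_linear_compose[OF bounded_linear_scaleC] bT bS)+
  have S_form: "cinner (S x) y = cinner x (T y)" for x y
    by (metis adj cinner_commute)
  have P_selfadj: "cinner (P \<theta> x) y = cinner x (P \<theta> y)" for \<theta> x y
    by (simp add: P_def cinner.add_left cinner.add_right cinner_scaleC_left cinner_scaleC_right
        adj S_form)
  have P_form: "cinner (P \<theta> x) x = complex_of_real (2 * Re (e \<theta> * cinner (T x) x))" for \<theta> x
  proof -
    have "cinner (S x) x = cnj (cinner (T x) x)" by (metis S_form cinner_commute)
    then show ?thesis
      using complex_add_cnj[of "e \<theta> * cinner (T x) x"]
      by (simp add: P_def cinner.add_left cinner_scaleC_left)
  qed
  let ?w = "numerical_radius T"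
  have w_nonneg: "0 \<le> ?w" by (rule numerical_radius_nonneg[OF T])
  have P_le: "onorm (P \<theta>) \<le> 2 * ?w" for \<theta>
  proof -
    have "cmod (cinner (P \<theta> x) x) \<le> 2 * ?w * (norm x)\<^sup>2" for x
    proof -
      have "cmod (cinner (P \<theta> x) x) = 2 * \<bar>Re (e \<theta> * cinner (T x) x)\<bar>"
        unfolding P_form by (simp only: norm_of_real abs_mult abs_numeral)
      also have "\<dots> \<le> 2 * cmod (cinner (T x) x)"
        using abs_Re_le_cmod[of "e \<theta> * cinner (T x) x"] by (simp add: norm_mult cmod_e)
      finally show ?thesis using quadratic_form_le_numerical_radius[OF T, of x] by linarith
    qed
    from norm_le_of_quadratic_form_le[OF bP P_selfadj this] show ?thesis
      by (intro onorm_bound) (simp_all add: w_nonneg)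
  qed
  have w_le: "?w \<le> c / 2" if c: "\<And>\<theta>. onorm (P \<theta>) \<le> c" for c
  proof (rule numerical_radius_leI)
    show "0 \<le> c / 2" using order_trans[OF onorm_pos_le[OF bP] c[of 0]] by simp
    fix x :: 'a assume x: "norm x = 1"
    \<comment> \<open>The rotation that makes the quadratic form real and nonnegative at \<open>x\<close>.\<close>
    obtain \<theta> where \<theta>: "e \<theta> * cinner (T x) x = complex_of_real (cmod (cinner (T x) x))"
      using unimodular_rotation unfolding e_def by blast
    have "2 * cmod (cinner (T x) x) = cmod (cinner (P \<theta> x) x)"
      unfolding P_form \<theta> by (simp add: norm_mult)
    also have "\<dots> \<le> norm (P \<theta> x) * norm x" by (rule cauchy_schwarz)
    also have "\<dots> \<le> onorm (P \<theta>)" using onorm[OF bP, of \<theta> x] x by simp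
    finally show "cmod (cinner (T x) x) \<le> c / 2" using c[of \<theta>] by simp
  qed
  have M_eq: "onorm (M \<theta>) = onorm (P (\<theta> - pi / 2))" for \<theta>
  proof -
    have rot: "e (\<theta> - pi / 2) = - \<i> * e \<theta>"
      using cis_divide[of \<theta> "pi / 2"] by (simp add: e_cis)
    have "\<i> * e (\<theta> - pi / 2) = e \<theta>" "\<i> * cnj (e (\<theta> - pi / 2)) = - cnj (e \<theta>)"
      by (simp_all add: rot)
    then have "M \<theta> v = \<i> *\<^sub>C P (\<theta> - pi / 2) v" for v
      by (simp add: M_def P_def scaleC_add_right scaleC_scaleC complex_vector.scale_minus_left)
    then have "norm (M \<theta> v) = norm (P (\<theta> - pi / 2) v)" for v
      by (simp add: norm_scaleC)
    then show ?thesis by (simp add: onorm_def)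
  qed
  have T_le: "2 * onorm T \<le> onorm (P \<theta>) + onorm (M \<theta>)" for \<theta>
  proof -
    have "norm (T v) \<le> (onorm (P \<theta>) + onorm (M \<theta>)) / 2 * norm v" for v
    proof -
      have "P \<theta> v + M \<theta> v = 2 *\<^sub>R (e \<theta> *\<^sub>C T v)"
        by (simp add: P_def M_def scaleR_2)
      then have "2 * norm (T v) = norm (P \<theta> v + M \<theta> v)"
        by (simp add: norm_scaleC cmod_e)
      also have "\<dots> \<le> onorm (P \<theta>) * norm v + onorm (M \<theta>) * norm v"
        by (intro norm_triangle_mono onorm bP bM)
      finally show ?thesis by (simp add: field_simps)
    qed
    then have "onorm T \<le> (onorm (P \<theta>) + onorm (M \<theta>)) / 2"
      by (intro onorm_bound) (simp_all add: onorm_pos_le bP bM)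
    then show ?thesis by simp
  qed
  have "?w = onorm T / 2 \<longleftrightarrow> (\<forall>\<theta>. onorm (P \<theta>) = onorm (M \<theta>) \<and> onorm (M \<theta>) = onorm T)"
  proof
    assume "?w = onorm T / 2"
    then have "onorm (P \<theta>) \<le> onorm T" "onorm (M \<theta>) \<le> onorm T" for \<theta>
      using P_le[of \<theta>] P_le[of "\<theta> - pi / 2"] by (simp_all add: M_eq)
    note le = this
    show "\<forall>\<theta>. onorm (P \<theta>) = onorm (M \<theta>) \<and> onorm (M \<theta>) = onorm T"
    proof
      show "onorm (P \<theta>) = onorm (M \<theta>) \<and> onorm (M \<theta>) = onorm T" for \<theta>
        using le(1)[of \<theta>] le(2)[of \<theta>] T_le[of \<theta>] by argo
    qed
  next
    assume *: "\<forall>\<theta>. onorm (P \<theta>) = onorm (M \<theta>) \<and> onorm (M \<theta>) = onorm T"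
    then have "?w \<le> onorm T / 2" by (intro w_le) simp
    moreover have "onorm T \<le> 2 * ?w" using P_le[of 0] * by simp
    ultimately show "?w = onorm T / 2" by simp
  qed
  then show ?thesis
    by (simp only: P_fun M_fun)
qed

section \<open>Extending a densely defined bounded operator\<close>

text \<open>The operator is given by its graph, because an element of a span has many representations
  and single-valuedness is itself a consequence of the bound. The bound passes to limits of pairs
  in \<open>G\<close>; it makes the limit relation \<open>L\<close> single-valued (apply it to differences), and total,
  since second components are Cauchy when first components are.\<close>

lemma extend_dense_graph:
  fixes G :: "'a::complex_inner \<Rightarrow> 'b::chilbert_space \<Rightarrow> bool"
  assumes add: "\<And>v w v' w'. G v w \<Longrightarrow> G v' w' \<Longrightarrow> G (v + v') (w + w')"
    and scale: "\<And>c v w. G v w \<Longrightarrow> G (c *\<^sub>C v) (c *\<^sub>C w)"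
    and bound: "\<And>v w. G v w \<Longrightarrow> norm w \<le> C * norm v"
    and dense: "closure {v. \<exists>w. G v w} = UNIV"
  obtains T where "bounded_clinear T" "\<And>v w. G v w \<Longrightarrow> T v = w"
    "\<And>v. norm (T v) \<le> C * norm v"
proof -
  define L where "L v w \<longleftrightarrow> (\<exists>p q. (\<forall>n. G (p n) (q n)) \<and> p \<longlonglongrightarrow> v \<and> q \<longlonglongrightarrow> w)" for v w
  have L_add: "L (v + v') (w + w')" if "L v w" "L v' w'" for v w v' w'
  proof -
    obtain p q where "\<And>n. G (p n) (q n)" "p \<longlonglongrightarrow> v" "q \<longlonglongrightarrow> w"
      using \<open>L v w\<close> unfolding L_def by blast
    moreover obtain p' q' where "\<And>n. G (p' n) (q' n)" "p' \<longlonglongrightarrow> v'" "q' \<longlonglongrightarrow> w'"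
      using \<open>L v' w'\<close> unfolding L_def by blast
    ultimately show ?thesis
      unfolding L_def
      by (intro exI[of _ "\<lambda>n. p n + p' n"] exI[of _ "\<lambda>n. q n + q' n"]) (simp add: add tendsto_add)
  qed
  have L_scale: "L (c *\<^sub>C v) (c *\<^sub>C w)" if "L v w" for c v w
  proof -
    obtain p q where "\<And>n. G (p n) (q n)" "p \<longlonglongrightarrow> v" "q \<longlonglongrightarrow> w"
      using \<open>L v w\<close> unfolding L_def by blast
    then show ?thesis
      unfolding L_def
      by (intro exI[of _ "\<lambda>n. c *\<^sub>C p n"] exI[of _ "\<lambda>n. c *\<^sub>C q n"])
        (simp add: scale bounded_linear.tendsto[OF bounded_linear_scaleC])
  qed
  have L_bound: "norm w \<le> C * norm v" if "L v w" for v w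
  proof -
    obtain p q where "\<And>n. G (p n) (q n)" "p \<longlonglongrightarrow> v" "q \<longlonglongrightarrow> w"
      using \<open>L v w\<close> unfolding L_def by blast
    then show ?thesis
      by (intro LIMSEQ_le[OF tendsto_norm tendsto_mult_left[OF tendsto_norm]]) (auto intro: bound)
  qed
  have L_unique: "w = w'" if "L v w" "L v w'" for v w w'
    using L_bound[OF L_add[OF that(1) L_scale[OF that(2), of "- 1"]]]
    by (simp add: complex_vector.scale_minus_left scaleC_one)
  have L_total: "\<exists>w. L v w" for v
  proof -
    have "v \<in> closure {v. \<exists>w. G v w}" by (simp add: dense)
    then obtain p where p: "\<And>n. \<exists>w. G (p n) w" "p \<longlonglongrightarrow> v"
      unfolding closure_sequential by blast
    then obtain q where q: "\<And>n. G (p n) (q n)" by metis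
    have "norm (q m - q n) \<le> C * norm (p m - p n)" for m n
      using bound[OF add[OF q[of m] scale[OF q[of n], of "- 1"]]]
      by (simp add: complex_vector.scale_minus_left scaleC_one)
    then have lip: "dist (q m) (q n) \<le> \<bar>C\<bar> * dist (p m) (p n)" for m n
      by (metis abs_ge_self dist_norm mult_right_mono norm_ge_zero order_trans)
    have "Cauchy q"
    proof (rule metric_CauchyI)
      fix e :: real assume e: "0 < e"
      then obtain N where N: "\<And>m n. m \<ge> N \<Longrightarrow> n \<ge> N \<Longrightarrow> dist (p m) (p n) < e / (\<bar>C\<bar> + 1)"
        using metric_CauchyD[OF LIMSEQ_imp_Cauchy[OF p(2)], of "e / (\<bar>C\<bar> + 1)"] by auto
      have "dist (q m) (q n) < e" if "m \<ge> N" "n \<ge> N" for m n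
      proof -
        have "\<bar>C\<bar> * dist (p m) (p n) \<le> (\<bar>C\<bar> + 1) * dist (p m) (p n)"
          by (intro mult_right_mono) auto
        moreover have "(\<bar>C\<bar> + 1) * dist (p m) (p n) < e"
          using N[OF that] by (simp add: pos_less_divide_eq mult.commute)
        ultimately show ?thesis using lip[of m n] by linarith
      qed
      then show "\<exists>M. \<forall>m\<ge>M. \<forall>n\<ge>M. dist (q m) (q n) < e" by blast
    qed
    then obtain w where "q \<longlonglongrightarrow> w" using Cauchy_convergent convergent_def by blast
    with p q show ?thesis unfolding L_def by blast
  qed
  then obtain T where T: "\<And>v. L v (T v)" by metis
  show thesis
  proof (rule that)
    show "bounded_clinear T"
      by (rule bounded_clinear_intro[where K = C])
        (blast intro: L_unique T L_add L_scale L_bound)+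
    show "norm (T v) \<le> C * norm v" for v by (rule L_bound[OF T])
    show "T v = w" if "G v w" for v w
    proof -
      have "L v w" unfolding L_def
        by (rule exI[of _ "\<lambda>_. v"], rule exI[of _ "\<lambda>_. w"]) (simp add: that)
      with T show ?thesis by (rule L_unique)
    qed
  qed
qed

section \<open>Tensor products of operators\<close>

text \<open>The pairs \<open>(\<Sum>\<^sub>i x\<^sub>i \<otimes> y\<^sub>i, \<Sum>\<^sub>i A x\<^sub>i \<otimes> B y\<^sub>i)\<close> over finite families. Scalar
  coefficients are absorbed into the \<open>x\<^sub>i\<close>.\<close>

inductive tensor_graph :: "('a \<Rightarrow> 'b \<Rightarrow> 'c::monoid_add) \<Rightarrow> ('a \<Rightarrow> 'a) \<Rightarrow> ('b \<Rightarrow> 'b) \<Rightarrow> 'c \<Rightarrow> 'c \<Rightarrow> bool"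
  for t A B where
  zero: "tensor_graph t A B 0 0"
| add: "tensor_graph t A B v w \<Longrightarrow> tensor_graph t A B (v + t x y) (w + t (A x) (B y))"

lemma tensor_graph_sum:
  fixes t :: "'a \<Rightarrow> 'b \<Rightarrow> 'c::monoid_add"
  assumes "tensor_graph t A B v' w'" "tensor_graph t A B v w"
  shows "tensor_graph t A B (v + v') (w + w')"
  using assms(1)
proof induction
  case zero
  then show ?case using assms(2) by simp
next
  case (add v' w' x y)
  then show ?case using tensor_graph.add[of t A B "v + v'" "w + w'" x y] by (simp add: add.assoc)
qed

lemma tensor_graph_flip:
  assumes "tensor_graph t A B v w"
  shows "tensor_graph (\<lambda>y x. t x y) B A v w"
  using assms by induction (auto intro: tensor_graph.intros)

text \<open>The relational form of \<open>A \<otimes> B = (I \<otimes> B) (A \<otimes> I)\<close>: the intermediate vector is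
  \<open>\<Sum>\<^sub>i A x\<^sub>i \<otimes> y\<^sub>i\<close>.\<close>

lemma tensor_graph_factor:
  assumes "tensor_graph t A B v w"
  shows "\<exists>u. tensor_graph t A (\<lambda>y. y) v u \<and> tensor_graph t (\<lambda>x. x) B u w"
  using assms by induction (blast intro: tensor_graph.intros)+

context hilbert_tensor_product
begin

text \<open>Exchanging the factors transfers bounds for \<open>A \<otimes> I\<close> to \<open>I \<otimes> B\<close>.\<close>

lemma flip: "hilbert_tensor_product (\<lambda>y x. tensor x y)"
proof
  have "{tensor x y | y x. True} = {tensor x y | x y. True}" by blast
  then show "closure (complex_vector.span {tensor x y | y x. True}) = UNIV"
    using dense_span_tensor by simp
qed (simp_all add: tensor_add_left tensor_add_right tensor_scaleC_left tensor_scaleC_right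
      cinner_tensor mult.commute)

lemma norm_tensor: "norm (tensor x y) = norm x * norm y"
proof -
  have "complex_of_real ((norm (tensor x y))\<^sup>2)
      = complex_of_real ((norm x)\<^sup>2) * complex_of_real ((norm y)\<^sup>2)"
    by (simp only: cinner_self[symmetric] cinner_tensor)
  then have "(norm (tensor x y))\<^sup>2 = (norm x * norm y)\<^sup>2"
    by (simp add: power_mult_distrib flip: of_real_mult of_real_power)
  then show ?thesis
    by (simp add: power2_eq_iff_nonneg)
qed

sublocale tensor: bounded_bilinear tensor
proof
  show "\<exists>K. \<forall>a b. norm (tensor a b) \<le> norm a * norm b * K"
    by (rule exI[of _ 1]) (simp add: norm_tensor)
qed (simp_all add: tensor_add_left tensor_add_right scaleR_scaleC tensor_scaleC_left
      tensor_scaleC_right)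

lemma span_tensor_induct [consumes 1, case_names zero add]:
  assumes "v \<in> complex_vector.span {tensor x y | x y. True}"
    and "P 0" "\<And>v x y. P v \<Longrightarrow> P (v + tensor x y)"
  shows "P v"
  using assms(1)
proof (induction rule: complex_vector.span_induct_alt)
  case (step c z v)
  then obtain x y where "z = tensor x y" by blast
  then have "c *\<^sub>C z + v = v + tensor (c *\<^sub>C x) y"
    by (simp add: tensor_scaleC_left add.commute)
  with step assms(3) show ?case by metis
qed (rule assms(2))

text \<open>Closed properties need to be checked only for finite sums of simple tensors; this is how
  identities between bounded operators on the tensor product are proved below.\<close>

lemma dense_tensor_induct [case_names closed zero add]:
  assumes "closed {v. P v}"
    and "P 0" "\<And>v x y. P v \<Longrightarrow> P (v + tensor x y)"
  shows "P v"
proof -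
  have "complex_vector.span {tensor x y | x y. True} \<subseteq> {v. P v}"
    using span_tensor_induct[of _ P] assms(2,3) by blast
  then have "closure (complex_vector.span {tensor x y | x y. True}) \<subseteq> {v. P v}"
    using assms(1) by (rule closure_minimal)
  then show ?thesis unfolding dense_span_tensor by blast
qed

lemma tensor_graph_scale:
  assumes "bounded_clinear A" "tensor_graph tensor A B v w"
  shows "tensor_graph tensor A B (c *\<^sub>C v) (c *\<^sub>C w)"
  using assms(2)
proof induction
  case zero
  show ?case by (simp add: tensor_graph.zero)
next
  case (add v w x y)
  then show ?case
    using tensor_graph.add[of tensor A B "c *\<^sub>C v" "c *\<^sub>C w" "c *\<^sub>C x" y]
    by (simp add: scaleC_add_right tensor_scaleC_left bounded_clinearD(3)[OF assms(1)])
qed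

text \<open>Gram--Schmidt, one summand at a time: the second factor \<open>y\<close> of a new summand \<open>x \<otimes> y\<close>
  splits into its component in the span of \<open>E\<close>, which only changes the coefficients \<open>f\<close>, and an
  orthogonal remainder \<open>r\<close>, which contributes a new unit vector unless it vanishes. The same
  rewriting is performed on \<open>v\<close> and \<open>w\<close> simultaneously; linearity of \<open>A\<close> keeps them
  matched.\<close>

lemma tensor_graph_orthonormal:
  assumes A: "bounded_clinear A" and "tensor_graph tensor A (\<lambda>y. y) v w"
  shows "\<exists>E f. finite E \<and> (\<forall>e\<in>E. \<forall>e'\<in>E. cinner e e' = (if e = e' then 1 else 0))
    \<and> v = (\<Sum>e\<in>E. tensor (f e) e) \<and> w = (\<Sum>e\<in>E. tensor (A (f e)) e)"
  using assms(2)
proof induction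
  case zero
  show ?case by (rule exI[of _ "{}"]) simp
next
  case (add v w x y)
  then obtain E f where E: "finite E"
    and on: "\<And>e e'. e \<in> E \<Longrightarrow> e' \<in> E \<Longrightarrow> cinner e e' = (if e = e' then 1 else 0)"
    and v: "v = (\<Sum>e\<in>E. tensor (f e) e)" and w: "w = (\<Sum>e\<in>E. tensor (A (f e)) e)"
    by blast
  interpret A: bounded_linear A using A by (rule bounded_clinearD)
  define r where "r = y - (\<Sum>e\<in>E. cinner y e *\<^sub>C e)"
  have r_orth: "cinner r e = 0" if "e \<in> E" for e
  proof -
    have "(\<Sum>e'\<in>E. cinner y e' * cinner e' e) = (\<Sum>e'\<in>E. if e' = e then cinner y e else 0)"
      using on that by (intro sum.cong) auto
    then show ?thesis
      using that E by (simp add: r_def cinner.diff_left cinner.sum_left cinner_scaleC_left)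
  qed
  define g where "g e = f e + cinner y e *\<^sub>C x" for e
  have expand: "tensor z y = (\<Sum>e\<in>E. tensor (cinner y e *\<^sub>C z) e) + tensor z r" for z
  proof -
    have "y = (\<Sum>e\<in>E. cinner y e *\<^sub>C e) + r" by (simp add: r_def)
    then have "tensor z y = tensor z (\<Sum>e\<in>E. cinner y e *\<^sub>C e) + tensor z r"
      by (metis tensor_add_right)
    then show ?thesis
      by (simp add: tensor.sum_right tensor_scaleC_left tensor_scaleC_right)
  qed
  have v': "v + tensor x y = (\<Sum>e\<in>E. tensor (g e) e) + tensor x r"
    by (simp add: v expand[of x] g_def tensor_add_left sum.distrib)
  have w': "w + tensor (A x) y = (\<Sum>e\<in>E. tensor (A (g e)) e) + tensor (A x) r"
    by (simp add: w expand[of "A x"] g_def tensor_add_left sum.distrib A.add bounded_clinearD(3)[OF A])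
  show ?case
  proof (cases "r = 0")
    case True
    show ?thesis
      by (rule exI[of _ E], rule exI[of _ g]) (simp add: v' w' True E on tensor.zero_right)
  next
    case False
    define u where "u = (1 / norm r) *\<^sub>R r"
    have r: "r = norm r *\<^sub>R u" using False by (simp add: u_def)
    have uu: "cinner u u = 1" using False by (simp add: cinner_self u_def)
    have uE: "cinner u e = 0" "cinner e u = 0" if "e \<in> E" for e
      using r_orth[OF that] cinner_commute[of e u] by (simp_all add: u_def cinner_scaleR_left)
    then have "u \<notin> E" using uu by force
    define g' where "g' = g(u := norm r *\<^sub>R x)"
    have g': "(\<Sum>e\<in>E. tensor (g' e) e) = (\<Sum>e\<in>E. tensor (g e) e)"
      "(\<Sum>e\<in>E. tensor (A (g' e)) e) = (\<Sum>e\<in>E. tensor (A (g e)) e)"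
      using \<open>u \<notin> E\<close> by (auto intro!: sum.cong simp: g'_def)
    have "tensor z r = tensor (norm r *\<^sub>R z) u" for z
      by (subst r) (simp add: tensor.scaleR_left tensor.scaleR_right)
    then have "v + tensor x y = (\<Sum>e\<in>insert u E. tensor (g' e) e)"
      "w + tensor (A x) y = (\<Sum>e\<in>insert u E. tensor (A (g' e)) e)"
      using E \<open>u \<notin> E\<close> by (simp_all add: v' w' g') (simp_all add: g'_def A.scaleR add.commute)
    moreover have "finite (insert u E)"
      "\<forall>e\<in>insert u E. \<forall>e'\<in>insert u E. cinner e e' = (if e = e' then 1 else 0)"
      using E on uu uE \<open>u \<notin> E\<close> by auto
    ultimately show ?thesis by blast
  qed
qed

lemma norm_sum_tensor_orthonormal:
  assumes E: "finite E"
    and on: "\<And>e e'. e \<in> E \<Longrightarrow> e' \<in> E \<Longrightarrow> cinner e e' = (if e = e' then 1 else 0)"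
  shows "(norm (\<Sum>e\<in>E. tensor (f e) e))\<^sup>2 = (\<Sum>e\<in>E. (norm (f e))\<^sup>2)"
proof -
  have "cinner (\<Sum>e\<in>E. tensor (f e) e) (\<Sum>e\<in>E. tensor (f e) e)
      = (\<Sum>e\<in>E. \<Sum>e'\<in>E. cinner (f e) (f e') * cinner e e')"
    by (simp add: cinner.sum_left cinner.sum_right cinner_tensor)
      (rule sum.swap)
  also have "\<dots> = (\<Sum>e\<in>E. \<Sum>e'\<in>E. if e' = e then cinner (f e) (f e) else 0)"
    using on by (intro sum.cong refl) auto
  also have "\<dots> = (\<Sum>e\<in>E. complex_of_real ((norm (f e))\<^sup>2))"
    using E by (simp add: cinner_self)
  finally show ?thesis
    by (simp add: cinner_self flip: of_real_sum of_real_power)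
qed

text \<open>After orthonormalisation, the claim is the bound \<open>\<parallel>A (f e)\<parallel> \<le> \<parallel>A\<parallel> \<parallel>f e\<parallel>\<close> squared and
  summed over \<open>e\<close>.\<close>

lemma tensor_graph_bound_left:
  assumes A: "bounded_clinear A" and G: "tensor_graph tensor A (\<lambda>y. y) v w"
  shows "norm w \<le> onorm A * norm v"
proof -
  note bA = bounded_clinearD(1)[OF A]
  obtain E f where E: "finite E"
    and on: "\<And>e e'. e \<in> E \<Longrightarrow> e' \<in> E \<Longrightarrow> cinner e e' = (if e = e' then 1 else 0)"
    and v: "v = (\<Sum>e\<in>E. tensor (f e) e)" and w: "w = (\<Sum>e\<in>E. tensor (A (f e)) e)"
    using tensor_graph_orthonormal[OF A G] by blast
  have "(norm w)\<^sup>2 = (\<Sum>e\<in>E. (norm (A (f e)))\<^sup>2)"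
    using norm_sum_tensor_orthonormal[OF E on, of "\<lambda>e. A (f e)"] w by simp
  also have "\<dots> \<le> (\<Sum>e\<in>E. (onorm A * norm (f e))\<^sup>2)"
    by (intro sum_mono power_mono onorm bA) simp
  also have "\<dots> = (onorm A * norm v)\<^sup>2"
    using norm_sum_tensor_orthonormal[OF E on, of f] v
    by (simp add: power_mult_distrib sum_distrib_left)
  finally show ?thesis
    by (rule power2_le_imp_le) (simp add: onorm_pos_le bA)
qed

lemma tensor_graph_bound:
  assumes A: "bounded_clinear A" and B: "bounded_clinear B" and G: "tensor_graph tensor A B v w"
  shows "norm w \<le> onorm A * onorm B * norm v"
proof -
  interpret flip: hilbert_tensor_product "\<lambda>y x. tensor x y" by (rule flip)
  obtain u where u: "tensor_graph tensor A (\<lambda>y. y) v u" "tensor_graph tensor (\<lambda>x. x) B u w"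
    using tensor_graph_factor[OF G] by blast
  have "norm w \<le> onorm B * norm u"
    using flip.tensor_graph_bound_left[OF B tensor_graph_flip[OF u(2)]] .
  also have "\<dots> \<le> onorm B * (onorm A * norm v)"
    by (intro mult_left_mono tensor_graph_bound_left[OF A u(1)] onorm_pos_le bounded_clinearD[OF B])
  finally show ?thesis by (simp add: mult_ac)
qed

lemma bounded_clinear_tensor_eqI:
  fixes S T :: "'c \<Rightarrow> 'c"
  assumes S: "bounded_clinear S" and T: "bounded_clinear T"
    and eq: "\<And>x y. S (tensor x y) = T (tensor x y)"
  shows "S = T"
proof
  note b = bounded_clinearD(1)[OF S] bounded_clinearD(1)[OF T]
  show "S v = T v" for v
  proof (induction v rule: dense_tensor_induct)
    case closed
    show ?case by (intro closed_Collect_eq linear_continuous_on b)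
  next
    case zero
    show ?case using b[THEN bounded_linear.linear] by (simp add: linear_0)
  next
    case (add v x y)
    then show ?case by (simp add: bounded_clinearD[OF S] bounded_clinearD[OF T] eq)
  qed
qed

context
  fixes A :: "'a \<Rightarrow> 'a" and B :: "'b \<Rightarrow> 'b"
  assumes A: "bounded_clinear A" and B: "bounded_clinear B"
begin

lemma tensor_op_exists:
  obtains T where "bounded_clinear T" "\<And>x y. T (tensor x y) = tensor (A x) (B y)"
    "\<And>v. norm (T v) \<le> onorm A * onorm B * norm v"
proof (rule extend_dense_graph[where G = "tensor_graph tensor A B" and C = "onorm A * onorm B"])
  have "v \<in> {v. \<exists>w. tensor_graph tensor A B v w}"
    if "v \<in> complex_vector.span {tensor x y | x y. True}" for v
    using that by (induction rule: span_tensor_induct) (auto intro: tensor_graph.intros)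
  then have "closure (complex_vector.span {tensor x y | x y. True})
      \<subseteq> closure {v. \<exists>w. tensor_graph tensor A B v w}"
    by (intro closure_mono) blast
  then show "closure {v. \<exists>w. tensor_graph tensor A B v w} = UNIV"
    unfolding dense_span_tensor by blast
next
  fix T assume T: "bounded_clinear T" "\<And>v w. tensor_graph tensor A B v w \<Longrightarrow> T v = w"
    "\<And>v. norm (T v) \<le> onorm A * onorm B * norm v"
  have "tensor_graph tensor A B (tensor x y) (tensor (A x) (B y))" for x y
    using tensor_graph.add[OF tensor_graph.zero, of tensor A B x y] by simp
  with T show thesis by (intro that) auto
qed (auto intro: tensor_graph_sum tensor_graph_scale tensor_graph_bound A B)

lemma tensor_op_properties:
  shows bounded_clinear_tensor_op: "bounded_clinear (tensor_op tensor A B)"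
    and tensor_op_tensor: "tensor_op tensor A B (tensor x y) = tensor (A x) (B y)"
    and norm_tensor_op_le: "norm (tensor_op tensor A B v) \<le> onorm A * onorm B * norm v"
proof -
  obtain T where T: "bounded_clinear T" "\<And>x y. T (tensor x y) = tensor (A x) (B y)"
    and bound: "\<And>v. norm (T v) \<le> onorm A * onorm B * norm v"
    using tensor_op_exists by metis
  have "tensor_op tensor A B = T"
    unfolding tensor_op_def using T by (intro the_equality) (auto intro: bounded_clinear_tensor_eqI)
  with T bound show "bounded_clinear (tensor_op tensor A B)"
    "tensor_op tensor A B (tensor x y) = tensor (A x) (B y)"
    "norm (tensor_op tensor A B v) \<le> onorm A * onorm B * norm v"
    by simp_all
qed

text \<open>For the lower bound, simple tensors suffice: their norms multiply, and the suprema over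
  \<open>x\<close> and \<open>y\<close> can be taken one after the other.\<close>

lemma onorm_tensor_op: "onorm (tensor_op tensor A B) = onorm A * onorm B"
proof (rule antisym)
  let ?T = "tensor_op tensor A B"
  note bT = bounded_clinearD(1)[OF bounded_clinear_tensor_op]
  show "onorm ?T \<le> onorm A * onorm B"
    by (intro onorm_bound norm_tensor_op_le mult_nonneg_nonneg onorm_pos_le bounded_clinearD(1)
        A B)
  have simple: "norm (A x) * norm (B y) \<le> onorm ?T * norm x * norm y" for x y
    using onorm[OF bT, of "tensor x y"] by (simp add: tensor_op_tensor norm_tensor mult.assoc)
  have "onorm A * norm (B y) \<le> onorm ?T * norm y" for y
  proof (cases "B y = 0")
    case False
    have "onorm A \<le> onorm ?T * norm y / norm (B y)"
      using simple[of _ y] False by (intro onorm_bound) (simp_all add: field_simps onorm_pos_le bT)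
    then show ?thesis using False by (simp add: field_simps)
  qed (simp add: onorm_pos_le bT)
  then have simple': "norm (B y) * onorm A \<le> onorm ?T * norm y" for y
    by (simp add: mult.commute)
  show "onorm A * onorm B \<le> onorm ?T"
  proof (cases "onorm A = 0")
    case False
    then have "0 < onorm A" using onorm_pos_le[OF bounded_clinearD(1)[OF A]] by simp
    then have "onorm B \<le> onorm ?T / onorm A"
      using simple' by (intro onorm_bound) (simp_all add: field_simps onorm_pos_le bT)
    then show ?thesis using \<open>0 < onorm A\<close> by (simp add: field_simps)
  qed (simp add: onorm_pos_le bT)
qed

end

text \<open>Both sides are continuous and additive in \<open>v\<close> and in \<open>w\<close>, so the identity reduces to
  simple tensors, where it is the product of the adjoint identities of the factors.\<close>

lemma cinner_tensor_op:
  assumes A: "bounded_clinear A" and B: "bounded_clinear B"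
  shows "cinner (tensor_op tensor A B v) w
    = cinner v (tensor_op tensor (cadjoint A) (cadjoint B) w)"
proof -
  note A' = bounded_clinear_cadjoint[OF A] and B' = bounded_clinear_cadjoint[OF B]
  let ?T = "tensor_op tensor A B" and ?S = "tensor_op tensor (cadjoint A) (cadjoint B)"
  note T = bounded_clinear_tensor_op[OF A B] and S = bounded_clinear_tensor_op[OF A' B']
  interpret T: bounded_linear ?T by (rule bounded_clinearD[OF T])
  interpret S: bounded_linear ?S by (rule bounded_clinearD[OF S])
  have simple: "cinner (?T (tensor x y)) w = cinner (tensor x y) (?S w)" for x y w
  proof (induction w rule: dense_tensor_induct)
    case closed
    show ?case
      by (intro closed_Collect_eq linear_continuous_on
          bounded_linear_compose[OF cinner.bounded_linear_right S.bounded_linear_axioms]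
          cinner.bounded_linear_right)
  next
    case (add w z u)
    then show ?case
      by (simp add: S.add cinner.add_right tensor_op_tensor[OF A B] tensor_op_tensor[OF A' B']
          cinner_tensor cinner_cadjoint[OF A] cinner_cadjoint[OF B])
  qed (simp add: S.zero cinner.zero_right)
  show ?thesis
  proof (induction v rule: dense_tensor_induct)
    case closed
    show ?case
      by (intro closed_Collect_eq linear_continuous_on
          bounded_linear_compose[OF cinner.bounded_linear_left T.bounded_linear_axioms]
          cinner.bounded_linear_left)
  qed (simp_all add: T.zero T.add cinner.zero_left cinner.add_left simple)
qed

end

theorem proposition2p10:
  fixes tensor :: "'h::chilbert_space \<Rightarrow> 'k::chilbert_space \<Rightarrow> 'hk::chilbert_space"
    and A :: "'h \<Rightarrow> 'h" and B :: "'k \<Rightarrow> 'k"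
  assumes "hilbert_tensor_product tensor"
    and "bounded_clinear A"
    and "bounded_clinear B"
  shows "numerical_radius (tensor_op tensor A B) = onorm A * onorm B / 2 \<longleftrightarrow>
    (\<forall>\<theta>::real.
      onorm (\<lambda>v. exp (\<i> * complex_of_real \<theta>) *\<^sub>C tensor_op tensor A B v
                + exp (- \<i> * complex_of_real \<theta>) *\<^sub>C tensor_op tensor (cadjoint A) (cadjoint B) v)
        = onorm (\<lambda>v. exp (\<i> * complex_of_real \<theta>) *\<^sub>C tensor_op tensor A B v
                - exp (- \<i> * complex_of_real \<theta>) *\<^sub>C tensor_op tensor (cadjoint A) (cadjoint B) v)
    \<and> onorm (\<lambda>v. exp (\<i> * complex_of_real \<theta>) *\<^sub>C tensor_op tensor A B v
                - exp (- \<i> * complex_of_real \<theta>) *\<^sub>C tensor_op tensor (cadjoint A) (cadjoint B) v)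
        = onorm A * onorm B)"

proof -
  interpret hilbert_tensor_product tensor by fact
  note A = \<open>bounded_clinear A\<close> and B = \<open>bounded_clinear B\<close>
  show ?thesis
    using numerical_radius_eq_half_norm_iff[OF bounded_clinear_tensor_op[OF A B]
        bounded_clinear_tensor_op[OF bounded_clinear_cadjoint[OF A] bounded_clinear_cadjoint[OF B]]
        cinner_tensor_op[OF A B]]
    unfolding onorm_tensor_op[OF A B] .
qed

end
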